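(* Let $(f_k)_{k\geq0}\subset L_p(0,1)$ be an arbitrary sequence of independent random variables and let $f=\bigoplus_{k\ge0}f_k$ be their disjoint sum. (1) For all $0<p\leq q<\infty$, $$\Big\|\ \Big\|\sum_{k\geq0}f_ke_k\Big\|_{\ell_q}\ \Big\|_{L_p}\approx_{p,q} \|f\|_{L_p+L_q}.$$ (2) For all $0<q\leq p<\infty$, $$\Big\|\ \Big\|\sum_{k\geq0}f_ke_k\Big\|_{\ell_q}\ \Big\|_{L_p}\approx_{p,q} \|f\|_{L_p\cap L_q}.$$ Here $\approx_{p,q}$ means that the ratio of the two sides is bounded above and below by positive constants depending only on $p$ and $q$.
   Context: Random variables are measurable functions on $(0,1)$ with Lebesgue measure. $(e_k)_{k\ge0}$ is the standard unit basis of sequence space, so $\|\sum_k f_ke_k\|_{\ell_q}$ is the function $t\mapsto\big(\sum_k|f_k(t)|^q\big)^{1/q}$, whose $L_p(0,1)$ (quasi-)norm is taken. The disjoint sum $\bigoplus_{k}f_k$ is the function on $(0,\infty)$ given by $\sum_k g_k$, where $g_k$ is a disjoint copy of $f_k$, e.g. $g_k(t)=f_k(t-k)\chi_{[k,k+1)}(t)$. The spaces $L_p+L_q$ and $L_p\cap L_q$ are on $(0,\infty)$, with $\|f\|_{L_p+L_q}=\inf\{\|g\|_p+\|h\|_q: f=g+h\}$ and $\|f\|_{L_p\cap L_q}=\max\{\|f\|_p,\|f\|_q\}$. (Quasi-)norms of elements not in the space are taken to be $\infty$. *)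

theory Defs
  imports "HOL-Probability.Probability"
begin

(* The exponent is meant to be positive, so that \<top> is sent to \<top>. *)
definition enn_powr :: "ennreal \<Rightarrow> real \<Rightarrow> ennreal" where
  "enn_powr x a = (if x = \<top> then \<top> else ennreal (enn2real x powr a))"

(* Takes an extended nonnegative function F, so that it also applies to pointwise sequence
   norms, which may be infinite; the L_p quasi-norm of a real function f is obtained
   from F = |f|. *)
definition Lp_qnorm :: "'a measure \<Rightarrow> real \<Rightarrow> ('a \<Rightarrow> ennreal) \<Rightarrow> ennreal" where
  "Lp_qnorm M p F = enn_powr (\<integral>\<^sup>+ t. enn_powr (F t) p \<partial>M) (1 / p)"

abbreviation Lp_qnorm_real :: "'a measure \<Rightarrow> real \<Rightarrow> ('a \<Rightarrow> real) \<Rightarrow> ennreal" where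
  "Lp_qnorm_real M p f \<equiv> Lp_qnorm M p (\<lambda>t. ennreal \<bar>f t\<bar>)"

definition Lp_space :: "'a measure \<Rightarrow> real \<Rightarrow> ('a \<Rightarrow> real) set" where
  "Lp_space M p = {f \<in> borel_measurable M. Lp_qnorm_real M p f < \<top>}"

definition lq_qnorm :: "real \<Rightarrow> (nat \<Rightarrow> real) \<Rightarrow> ennreal" where
  "lq_qnorm q x = enn_powr (\<Sum>k. ennreal (\<bar>x k\<bar> powr q)) (1 / q)"

(* The infimum over the empty set is \<top>, the value for f outside L_p + L_q. *)
definition Lp_plus_Lq_qnorm :: "'a measure \<Rightarrow> real \<Rightarrow> real \<Rightarrow> ('a \<Rightarrow> real) \<Rightarrow> ennreal" where
  "Lp_plus_Lq_qnorm M p q f =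
     Inf {Lp_qnorm_real M p g + Lp_qnorm_real M q h | g h.
            g \<in> Lp_space M p \<and> h \<in> Lp_space M q \<and> (AE t in M. f t = g t + h t)}"

definition Lp_inter_Lq_qnorm :: "'a measure \<Rightarrow> real \<Rightarrow> real \<Rightarrow> ('a \<Rightarrow> real) \<Rightarrow> ennreal" where
  "Lp_inter_Lq_qnorm M p q f = max (Lp_qnorm_real M p f) (Lp_qnorm_real M q f)"

(* Each f k matters only on (0,1), hence the open intervals: t = k would evaluate f k at 0.
   For every t at most one summand is nonzero. *)
definition disjoint_sum :: "(nat \<Rightarrow> real \<Rightarrow> real) \<Rightarrow> real \<Rightarrow> real" where
  "disjoint_sum f t = (\<Sum>k. f k (t - real k) * indicator {real k<..<real k + 1} t)"

abbreviation unit_leb :: "real measure" where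
  "unit_leb \<equiv> lebesgue_on {0<..<1}"

abbreviation halfline_leb :: "real measure" where
  "halfline_leb \<equiv> lebesgue_on {0<..}"

(* Needed to use prob_space.indep_vars on this space. *)
lemma prob_space_unit_leb: "prob_space unit_leb"
  by (rule prob_spaceI) (simp add: space_restrict_space emeasure_restrict_space)

end

theory Submission
  imports Defs
begin

text \<open>
  Put $X_k = |f_k|^q$, $S = \<Sum>_k X_k$ and $r = p/q$. The mixed norm is $(E S^r)^{1/p}$, and integrals
  over the half-line of functions of the disjoint sum are sums over $k$ of expectations of functions
  of $X_k$ (\<open>nn_integral_halfline\<close>). So the claim compares $E S^r$ with sums of expectations
  of the single $X_k$. Independence is used in one form only: $X_k$ is independent of
  $R_k = S - X_k$ (\<open>nn_integral_mult_sum_without\<close>).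

  For $q \<le> p$, that is $r \<ge> 1$, the claim reads $E S^r \<approx> \<Sum>_k E X_k^r + (\<Sum>_k E X_k)^r$. The lower
  bound is superadditivity of the $r$-th power together with Jensen's inequality. The upper bound is
  Rosenthal's inequality for nonnegative summands (\<open>Rosenthal_nonneg\<close>), obtained by expanding
  $S^r = \<Sum>_k X_k S^{r-1}$, separating $X_k$ from $R_k$ in $S^{r-1}$, and absorbing.

  For $p \<le> q$, that is $r \<le> 1$, the upper bound holds for every decomposition of the disjoint sum,
  by subadditivity of the $r$-th power on the $L_p$ part and Jensen's inequality on the $L_q$ part. For the
  lower bound a good decomposition must be found. Truncating at the level $T = (2 E S^r)^{1/r}$
  works: Markov's inequality gives $S \<le> T$, hence $R_k \<le> T$, with probability at least $1/2$, so that by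
  independence restriction to $R_k \<le> T$ costs only a factor $2$ in the expectation of any function
  of $X_k$. At most one $k$ satisfies $X_k > T \<ge> R_k$, so the large values contribute at
  most $S^r$; and the small values contribute only where $S \<le> 2T$, hence at most $2T$
  (\<open>sum_moments_large_part_le\<close>, \<open>sum_means_small_part_le\<close>).
\<close>

section \<open>Powers of extended nonnegative numbers and their integrals\<close>

lemma enn_powr_ennreal: "0 \<le> x \<Longrightarrow> enn_powr (ennreal x) a = ennreal (x powr a)"
  by (simp add: enn_powr_def)

lemma enn_powr_top [simp]: "enn_powr \<top> a = \<top>"
  by (simp add: enn_powr_def)

lemma enn_powr_zero [simp]: "enn_powr 0 a = 0"
  by (simp add: enn_powr_def)

lemma enn_powr_one [simp]: "enn_powr x 1 = x"
  by (cases x) (auto simp: enn_powr_ennreal)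

lemma enn_powr_mono: "0 \<le> a \<Longrightarrow> x \<le> y \<Longrightarrow> enn_powr x a \<le> enn_powr y a"
  by (cases x; cases y) (auto simp: enn_powr_ennreal top_unique intro!: ennreal_leI powr_mono2)

lemma enn_powr_powr: "enn_powr (enn_powr x a) b = enn_powr x (a * b)"
  by (cases x) (auto simp: enn_powr_ennreal powr_powr)

lemma enn_powr_cmult:
  "0 < c \<Longrightarrow> enn_powr (ennreal c * x) a = ennreal (c powr a) * enn_powr x a"
  by (cases x) (auto simp: enn_powr_ennreal ennreal_mult_top powr_mult simp flip: ennreal_mult)

text \<open>
  This also holds for $r = 1$: there the exponent is $0$, and $0^0 = 0$ and $\<infinity>^0 = \<infinity>$
  under \<^const>\<open>enn_powr\<close>, so both sides agree at $x = 0$ and $x = \<infinity>$. The same conventions make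
  $x \<mapsto> x^0$ monotone, so that the case $r = 1$ is never exceptional below.
\<close>

lemma enn_powr_mult_self: "x * enn_powr x (r - 1) = enn_powr x r"
  by (cases x) (auto simp: enn_powr_ennreal powr_mult_base ennreal_top_mult simp flip: ennreal_mult)

text \<open>
  For $a > 0$ the map $x \<mapsto> x^a$ is an order isomorphism of $[0, \<infinity>]$ with inverse
  $x \<mapsto> x^{1/a}$. This is how suprema pass through powers, and how exponents $r \<le> 1$
  are reduced to exponents $1/r \<ge> 1$.
\<close>

lemma enn_powr_le_iff:
  assumes "0 < a"
  shows "enn_powr x a \<le> y \<longleftrightarrow> x \<le> enn_powr y (1 / a)"
  using enn_powr_mono[of "1 / a" "enn_powr x a" y] enn_powr_mono[of a x "enn_powr y (1 / a)"] assms
  by (auto simp: enn_powr_powr)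

lemma enn_powr_SUP:
  assumes "0 < a"
  shows "enn_powr (SUP i\<in>I. x i) a = (SUP i\<in>I. enn_powr (x i) a)"
proof (rule antisym)
  show "enn_powr (SUP i\<in>I. x i) a \<le> (SUP i\<in>I. enn_powr (x i) a)"
    unfolding enn_powr_le_iff[OF assms]
  proof (rule SUP_least)
    fix i assume "i \<in> I"
    then show "x i \<le> enn_powr (SUP i\<in>I. enn_powr (x i) a) (1 / a)"
      unfolding enn_powr_le_iff[OF assms, symmetric] by (rule SUP_upper)
  qed
  show "(SUP i\<in>I. enn_powr (x i) a) \<le> enn_powr (SUP i\<in>I. x i) a"
    using assms by (intro SUP_least enn_powr_mono SUP_upper) auto
qed

lemma measurable_enn_powr [measurable]:
  assumes [measurable]: "f \<in> borel_measurable M"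
  shows "(\<lambda>x. enn_powr (f x) a) \<in> borel_measurable M"
  unfolding enn_powr_def by measurable

lemma enn_powr_add_le:
  assumes "0 \<le> a"
  shows "enn_powr (x + y) a \<le> ennreal (2 powr a) * (enn_powr x a + enn_powr y a)"
proof -
  have "enn_powr (x + y) a \<le> enn_powr (ennreal 2 * max x y) a"
    using assms by (intro enn_powr_mono) (auto simp: mult_2 intro: add_mono)
  also have "\<dots> = ennreal (2 powr a) * enn_powr (max x y) a"
    by (simp add: enn_powr_cmult del: ennreal_numeral)
  also have "\<dots> \<le> ennreal (2 powr a) * (enn_powr x a + enn_powr y a)"
    by (intro mult_left_mono) (auto simp: max_def add_increasing add_increasing2)
  finally show ?thesis .
qed

text \<open>
  Write $(x + y)^r = x (x + y)^{r-1} + y (x + y)^{r-1}$ and decrease each power to $x^{r-1}$ and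
  $y^{r-1}$.
\<close>

lemma enn_powr_superadditive:
  assumes "1 \<le> r"
  shows "enn_powr x r + enn_powr y r \<le> enn_powr (x + y) r"
proof -
  have "x * enn_powr x (r - 1) + y * enn_powr y (r - 1)
      \<le> x * enn_powr (x + y) (r - 1) + y * enn_powr (x + y) (r - 1)"
    using assms by (intro add_mono mult_left_mono enn_powr_mono) auto
  also have "\<dots> = (x + y) * enn_powr (x + y) (r - 1)"
    by (simp add: distrib_right)
  finally show ?thesis
    by (simp add: enn_powr_mult_self)
qed

lemma sum_enn_powr_le:
  assumes "1 \<le> r"
  shows "(\<Sum>k\<in>A. enn_powr (x k) r) \<le> enn_powr (\<Sum>k\<in>A. x k) r"
proof (induction A rule: infinite_finite_induct)
  case (insert k A)
  then have "(\<Sum>k\<in>insert k A. enn_powr (x k) r) \<le> enn_powr (x k) r + enn_powr (\<Sum>k\<in>A. x k) r"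
    by (simp add: add_left_mono)
  also have "\<dots> \<le> enn_powr (\<Sum>k\<in>insert k A. x k) r"
    using insert enn_powr_superadditive[OF assms, of "x k" "\<Sum>k\<in>A. x k"] by simp
  finally show ?case .
qed auto

lemma suminf_enn_powr_le:
  assumes "1 \<le> r"
  shows "(\<Sum>k. enn_powr (x k) r) \<le> enn_powr (\<Sum>k. x k) r"
proof (rule suminf_le_const)
  fix n
  have "(\<Sum>k<n. enn_powr (x k) r) \<le> enn_powr (\<Sum>k<n. x k) r"
    by (rule sum_enn_powr_le[OF assms])
  also have "\<dots> \<le> enn_powr (\<Sum>k. x k) r"
    using assms by (intro enn_powr_mono sum_le_suminf) auto
  finally show "(\<Sum>k<n. enn_powr (x k) r) \<le> enn_powr (\<Sum>k. x k) r" .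
qed auto

lemma enn_powr_suminf_le:
  assumes "0 < r" "r \<le> 1"
  shows "enn_powr (\<Sum>k. x k) r \<le> (\<Sum>k. enn_powr (x k) r)"
  unfolding enn_powr_le_iff[OF assms(1)]
  using suminf_enn_powr_le[of "1 / r" "\<lambda>k. enn_powr (x k) r"] assms
  by (simp add: enn_powr_powr)

text \<open>
  A form of Young's inequality with a free parameter: if $m \<le> d s$, the first term on the right
  dominates, and otherwise $s < m / d$ and the second one does. In Rosenthal's inequality a small
  $d$ lets the first term be absorbed.
\<close>

lemma mult_enn_powr_le_Young:
  assumes "1 \<le> r" "0 < d"
  shows "m * enn_powr s (r - 1)
    \<le> ennreal d * enn_powr s r + ennreal (d powr (1 - r)) * enn_powr m r"
proof (cases "m \<le> ennreal d * s")
  case True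
  then have "m * enn_powr s (r - 1) \<le> (ennreal d * s) * enn_powr s (r - 1)"
    by (rule mult_right_mono) simp
  also have "\<dots> = ennreal d * enn_powr s r"
    by (simp add: enn_powr_mult_self mult.assoc)
  finally show ?thesis
    by (simp add: add_increasing2)
next
  case False
  then have "ennreal (1 / d) * (ennreal d * s) \<le> ennreal (1 / d) * m"
    by (intro mult_left_mono) auto
  then have "s \<le> ennreal (1 / d) * m"
    using assms by (simp flip: mult.assoc ennreal_mult)
  then have "m * enn_powr s (r - 1) \<le> m * enn_powr (ennreal (1 / d) * m) (r - 1)"
    using assms by (intro mult_left_mono enn_powr_mono) auto
  also have "\<dots> = ennreal ((1 / d) powr (r - 1)) * enn_powr m r"
    using assms by (simp add: enn_powr_cmult mult.left_commute[of m] enn_powr_mult_self)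
  also have "(1 / d) powr (r - 1) = d powr (1 - r)"
    using assms by (simp add: powr_divide powr_diff)
  finally show ?thesis
    by (simp add: add_increasing)
qed

text \<open>
  Jensen's inequality up to a factor $2$, which is harmless here: with $n = (E X^r)^{1/r}$, integrate
  Young's inequality $X n^{r-1} \<le> X^r + n^r$ and divide by $n^{r-1}$.
\<close>

lemma (in prob_space) nn_integral_le_moment:
  assumes [measurable]: "X \<in> borel_measurable M" and "1 \<le> r"
  shows "(\<integral>\<^sup>+\<omega>. X \<omega> \<partial>M) \<le> 2 * enn_powr (\<integral>\<^sup>+\<omega>. enn_powr (X \<omega>) r \<partial>M) (1 / r)"
proof -
  define N where "N = (\<integral>\<^sup>+\<omega>. enn_powr (X \<omega>) r \<partial>M)"
  define n where "n = enn_powr N (1 / r)"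
  have n: "enn_powr n r = N"
    using assms by (simp add: n_def enn_powr_powr)
  consider "N = \<top>" | "N = 0" | "N \<noteq> 0" "N \<noteq> \<top>" by blast
  then show ?thesis
  proof cases
    case 1
    then show ?thesis by (simp add: N_def ennreal_mult_top)
  next
    case 2
    then have "AE \<omega> in M. enn_powr (X \<omega>) r = 0"
      unfolding N_def by (subst (asm) nn_integral_0_iff_AE) auto
    then have "AE \<omega> in M. X \<omega> = 0"
      by eventually_elim (metis assms(2) enn_powr_le_iff enn_powr_zero le_zero_eq
        less_le_trans order_refl zero_less_one)
    then have "(\<integral>\<^sup>+\<omega>. X \<omega> \<partial>M) = 0"
      by (subst nn_integral_0_iff_AE) auto
    then show ?thesis by simp
  next
    case 3
    then have "n \<noteq> 0" "n \<noteq> \<top>"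
      using n by auto
    then obtain n' where n': "n = ennreal n'" "0 < n'"
      by (cases n) (auto simp: less_le)
    have *: "enn_powr n (r - 1) = ennreal (n' powr (r - 1))" "0 < n' powr (r - 1)"
      using n' by (auto simp: enn_powr_ennreal)
    have young: "X \<omega> * enn_powr n (r - 1) \<le> enn_powr (X \<omega>) r + enn_powr n r" for \<omega>
      using mult_enn_powr_le_Young[OF assms(2), of 1 "X \<omega>" n] by (simp add: add.commute)
    have "(\<integral>\<^sup>+\<omega>. X \<omega> \<partial>M) * enn_powr n (r - 1) = (\<integral>\<^sup>+\<omega>. X \<omega> * enn_powr n (r - 1) \<partial>M)"
      by (rule nn_integral_multc[symmetric]) simp
    also have "\<dots> \<le> (\<integral>\<^sup>+\<omega>. enn_powr (X \<omega>) r + enn_powr n r \<partial>M)"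
      by (intro nn_integral_mono young)
    also have "\<dots> = 2 * enn_powr n r"
      by (subst nn_integral_add) (simp_all add: emeasure_space_1 n N_def[symmetric] mult_2)
    also have "\<dots> = (2 * n) * enn_powr n (r - 1)"
      by (simp add: mult.assoc enn_powr_mult_self)
    finally have "enn_powr n (r - 1) * (\<integral>\<^sup>+\<omega>. X \<omega> \<partial>M) \<le> enn_powr n (r - 1) * (2 * n)"
      by (simp only: mult.commute)
    then have "(\<integral>\<^sup>+\<omega>. X \<omega> \<partial>M) \<le> 2 * n"
      using * by (subst (asm) ennreal_mult_le_mult_iff) auto
    then show ?thesis by (simp add: n_def N_def)
  qed
qed

section \<open>Sums with one term left out\<close>

definition sum_without :: "nat \<Rightarrow> (nat \<Rightarrow> ennreal) \<Rightarrow> ennreal" where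
  "sum_without k x = (\<Sum>j. if j = k then 0 else x j)"

lemma suminf_eq_sum_without: "(\<Sum>j. x j) = x k + sum_without k x"
proof -
  have "x k = (\<Sum>j. if j = k then x j else 0)"
    by (subst suminf_finite[of "{k}"]) auto
  then have "x k + sum_without k x = (\<Sum>j. (if j = k then x j else 0) + (if j = k then 0 else x j))"
    unfolding sum_without_def by (subst suminf_add[symmetric]) auto
  also have "\<dots> = (\<Sum>j. x j)"
    by (rule suminf_cong) simp
  finally show ?thesis by simp
qed

lemma le_sum_without: "j \<noteq> k \<Longrightarrow> x j \<le> sum_without k x"
  using sum_le_suminf[of "\<lambda>j. if j = k then 0 else x j" "{j}"] by (simp add: sum_without_def)

lemma sum_without_le: "sum_without k x \<le> (\<Sum>j. x j)"
  by (simp add: suminf_eq_sum_without[of x k])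

lemma measurable_sum_without [measurable]:
  assumes [measurable]: "\<And>j. X j \<in> borel_measurable M"
  shows "(\<lambda>\<omega>. sum_without k (\<lambda>j. X j \<omega>)) \<in> borel_measurable M"
  unfolding sum_without_def by measurable

text \<open>
  The only way in which independence enters the whole development: $X_k$ is independent of
  the sum of all the other $X_j$.
\<close>

lemma (in prob_space) nn_integral_mult_sum_without:
  fixes X :: "nat \<Rightarrow> 'a \<Rightarrow> ennreal"
  assumes X: "indep_vars (\<lambda>_. borel) X UNIV"
    and [measurable]: "u \<in> borel_measurable borel" "v \<in> borel_measurable borel"
  shows "(\<integral>\<^sup>+\<omega>. u (X k \<omega>) * v (sum_without k (\<lambda>j. X j \<omega>)) \<partial>M)
    = (\<integral>\<^sup>+\<omega>. u (X k \<omega>) \<partial>M) * (\<integral>\<^sup>+\<omega>. v (sum_without k (\<lambda>j. X j \<omega>)) \<partial>M)"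
proof -
  let ?B = "- {k}" and ?PB = "PiM (- {k}) (\<lambda>_. borel :: ennreal measure)"
  have [measurable]: "(\<lambda>y. y j) \<in> borel_measurable ?PB" if "j \<noteq> k" for j
    using that by (intro measurable_component_singleton) auto
  have m: "(\<lambda>y. if j = k then 0 else y j) \<in> borel_measurable ?PB" for j
    by (cases "j = k") auto
  have "(\<lambda>y. sum_without k y) \<in> borel_measurable ?PB"
    unfolding sum_without_def using m by measurable
  then have "(\<lambda>y. v (sum_without k y)) \<in> borel_measurable ?PB"
    by measurable
  then have "indep_var borel ((\<lambda>y. u (y k)) \<circ> (\<lambda>\<omega>. restrict (\<lambda>i. X i \<omega>) {k}))
      borel ((\<lambda>y. v (sum_without k y)) \<circ> (\<lambda>\<omega>. restrict (\<lambda>i. X i \<omega>) ?B))"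
    by (intro indep_var_compose[OF indep_var_restrict[OF X]]) auto
  moreover have "sum_without k (restrict (\<lambda>i. X i \<omega>) ?B) = sum_without k (\<lambda>j. X j \<omega>)" for \<omega>
    unfolding sum_without_def by (rule suminf_cong) auto
  ultimately have "indep_var borel (\<lambda>\<omega>. u (X k \<omega>)) borel (\<lambda>\<omega>. v (sum_without k (\<lambda>j. X j \<omega>)))"
    by (simp add: comp_def)
  then have "indep_vars (\<lambda>_. borel)
      (case_bool (\<lambda>\<omega>. u (X k \<omega>)) (\<lambda>\<omega>. v (sum_without k (\<lambda>j. X j \<omega>)))) UNIV"
    unfolding indep_var_def by (rule iffD1[OF indep_vars_cong, rotated -1]) (auto split: bool.split)
  from indep_vars_nn_integral[OF _ this] show ?thesis
    by (simp add: UNIV_bool mult.commute)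
qed

section \<open>Rosenthal's inequality for nonnegative summands\<close>

lemma ennreal_le_half_add_imp:
  fixes x y :: ennreal
  assumes "x \<le> ennreal (1 / 2) * x + y" "x < \<top>"
  shows "x \<le> 2 * y"
proof (cases "y = \<top>")
  case False
  then obtain a b where ab: "x = ennreal a" "0 \<le> a" "y = ennreal b" "0 \<le> b"
    using assms(2) by (cases x; cases y) auto
  have "ennreal a \<le> ennreal (1 / 2 * a + b)"
    using assms(1) ab by (subst ennreal_plus) (auto simp only: ennreal_mult ab mult_nonneg_nonneg)
  then have "ennreal a \<le> ennreal (2 * b)"
    using ab by (intro ennreal_leI) (subst (asm) ennreal_le_iff, auto)
  then show ?thesis
    using ab by (simp add: ennreal_mult)
qed (simp add: ennreal_mult_top)

context prob_space
begin

text \<open>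
  Write $S^r = \<Sum>_k X_k S^{r-1}$ and $S = X_k + R_k$ with $R_k$ independent of $X_k$. Since
  $S^{r-1} \<le> 2^{r-1} (X_k^{r-1} + R_k^{r-1})$, taking expectations gives
  $E S^r \<le> 2^{r-1} (\<Sum>_k E X_k^r + m E S^{r-1})$ with $m = \<Sum>_k E X_k$.
  Young's inequality bounds $m E S^{r-1}$ by a small multiple of $E S^r$ plus a multiple of $m^r$.
  The small multiple can be moved to the left because $E S^r$ is finite.
\<close>

lemma Rosenthal_of_finite_moment:
  fixes X :: "nat \<Rightarrow> 'a \<Rightarrow> ennreal"
  assumes X: "indep_vars (\<lambda>_. borel) X UNIV" and r: "1 \<le> r"
    and fin: "(\<integral>\<^sup>+\<omega>. enn_powr (\<Sum>k. X k \<omega>) r \<partial>M) < \<top>"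
  shows "(\<integral>\<^sup>+\<omega>. enn_powr (\<Sum>k. X k \<omega>) r \<partial>M)
    \<le> ennreal (2 powr (r * r)) * ((\<Sum>k. \<integral>\<^sup>+\<omega>. enn_powr (X k \<omega>) r \<partial>M)
        + enn_powr (\<Sum>k. \<integral>\<^sup>+\<omega>. X k \<omega> \<partial>M) r)"
proof -
  have [measurable]: "X k \<in> borel_measurable M" for k
    using X by (auto simp: indep_vars_def)
  define S where "S = (\<lambda>\<omega>. \<Sum>k. X k \<omega>)"
  define R where "R = (\<lambda>k \<omega>. sum_without k (\<lambda>j. X j \<omega>))"
  define E where "E = (\<integral>\<^sup>+\<omega>. enn_powr (S \<omega>) r \<partial>M)"
  define F where "F = (\<integral>\<^sup>+\<omega>. enn_powr (S \<omega>) (r - 1) \<partial>M)"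
  define A where "A = (\<Sum>k. \<integral>\<^sup>+\<omega>. enn_powr (X k \<omega>) r \<partial>M)"
  define m where "m = (\<Sum>k. \<integral>\<^sup>+\<omega>. X k \<omega> \<partial>M)"
  define c :: real where "c = 2 powr (r - 1)"
  \<comment> \<open>The Young parameter is chosen so that $c d = 1/2$: half of $E S^r$ is absorbed.\<close>
  define d :: real where "d = 2 powr (- r)"
  have [measurable]: "S \<in> borel_measurable M" "R k \<in> borel_measurable M" for k
    unfolding S_def R_def by measurable
  have S_split: "S \<omega> = X k \<omega> + R k \<omega>" for k \<omega>
    unfolding S_def R_def by (rule suminf_eq_sum_without)
  have R_le: "R k \<omega> \<le> S \<omega>" for k \<omega>
    unfolding S_def R_def by (rule sum_without_le)
  have term_le: "(\<integral>\<^sup>+\<omega>. X k \<omega> * enn_powr (S \<omega>) (r - 1) \<partial>M)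
      \<le> ennreal c * ((\<integral>\<^sup>+\<omega>. enn_powr (X k \<omega>) r \<partial>M) + (\<integral>\<^sup>+\<omega>. X k \<omega> \<partial>M) * F)" for k
  proof -
    have "X k \<omega> * enn_powr (S \<omega>) (r - 1)
        \<le> X k \<omega> * (ennreal c * (enn_powr (X k \<omega>) (r - 1) + enn_powr (R k \<omega>) (r - 1)))" for \<omega>
      unfolding S_split[of \<omega> k] c_def using r by (intro mult_left_mono enn_powr_add_le) auto
    also have "X k \<omega> * (ennreal c * (enn_powr (X k \<omega>) (r - 1) + enn_powr (R k \<omega>) (r - 1)))
        = ennreal c * (enn_powr (X k \<omega>) r + X k \<omega> * enn_powr (R k \<omega>) (r - 1))" for \<omega>
      by (simp add: mult.left_commute[of "X k \<omega>"] distrib_left enn_powr_mult_self)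
    finally have "(\<integral>\<^sup>+\<omega>. X k \<omega> * enn_powr (S \<omega>) (r - 1) \<partial>M)
        \<le> (\<integral>\<^sup>+\<omega>. ennreal c * (enn_powr (X k \<omega>) r + X k \<omega> * enn_powr (R k \<omega>) (r - 1)) \<partial>M)"
      by (rule nn_integral_mono)
    also have "\<dots> = ennreal c * ((\<integral>\<^sup>+\<omega>. enn_powr (X k \<omega>) r \<partial>M)
        + (\<integral>\<^sup>+\<omega>. X k \<omega> * enn_powr (R k \<omega>) (r - 1) \<partial>M))"
      by (simp add: nn_integral_cmult nn_integral_add)
    also have "(\<integral>\<^sup>+\<omega>. X k \<omega> * enn_powr (R k \<omega>) (r - 1) \<partial>M)
        = (\<integral>\<^sup>+\<omega>. X k \<omega> \<partial>M) * (\<integral>\<^sup>+\<omega>. enn_powr (R k \<omega>) (r - 1) \<partial>M)"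
      unfolding R_def
      by (rule nn_integral_mult_sum_without[OF X, of "\<lambda>x. x" "\<lambda>x. enn_powr x (r - 1)"]) measurable
    also have "(\<integral>\<^sup>+\<omega>. enn_powr (R k \<omega>) (r - 1) \<partial>M) \<le> F"
      unfolding F_def using r by (intro nn_integral_mono enn_powr_mono R_le) simp
    finally show ?thesis
      by (simp add: mult_left_mono add_left_mono)
  qed
  have "E = (\<integral>\<^sup>+\<omega>. (\<Sum>k. X k \<omega> * enn_powr (S \<omega>) (r - 1)) \<partial>M)"
    unfolding E_def ennreal_suminf_multc S_def enn_powr_mult_self ..
  also have "\<dots> = (\<Sum>k. \<integral>\<^sup>+\<omega>. X k \<omega> * enn_powr (S \<omega>) (r - 1) \<partial>M)"
    by (rule nn_integral_suminf) measurable
  also have "\<dots> \<le> (\<Sum>k. ennreal c * ((\<integral>\<^sup>+\<omega>. enn_powr (X k \<omega>) r \<partial>M) + (\<integral>\<^sup>+\<omega>. X k \<omega> \<partial>M) * F))"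
    by (intro suminf_le term_le) auto
  also have "\<dots> = ennreal c * (A + m * F)"
    by (simp add: A_def m_def suminf_add[symmetric])
  also have "m * F = (\<integral>\<^sup>+\<omega>. m * enn_powr (S \<omega>) (r - 1) \<partial>M)"
    unfolding F_def by (rule nn_integral_cmult[symmetric]) measurable
  also have "\<dots> \<le> (\<integral>\<^sup>+\<omega>. ennreal d * enn_powr (S \<omega>) r + ennreal (d powr (1 - r)) * enn_powr m r \<partial>M)"
    using r by (intro nn_integral_mono mult_enn_powr_le_Young) (simp_all add: d_def)
  also have "\<dots> = ennreal d * E + ennreal (d powr (1 - r)) * enn_powr m r"
    by (simp add: nn_integral_add nn_integral_cmult emeasure_space_1 E_def)
  finally have E_le: "E \<le> ennreal c * (A + (ennreal d * E + ennreal (d powr (1 - r)) * enn_powr m r))"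
    by (simp add: mult_left_mono add_left_mono)
  have half: "(2 powr x) / 2 = 2 powr (x - 1)" for x :: real
    by (simp add: powr_diff)
  have cd: "c * d = 1 / 2" "c * d powr (1 - r) = 2 powr (r * r) / 2" "c \<le> 2 powr (r * r) / 2"
  proof -
    have "c * d = 2 powr (- 1)"
      unfolding c_def d_def powr_add[symmetric] by simp
    then show "c * d = 1 / 2"
      by (simp add: powr_minus_divide)
    have e: "r - 1 + - r * (1 - r) = r * r - 1"
      by (simp add: algebra_simps)
    show "c * d powr (1 - r) = 2 powr (r * r) / 2"
      unfolding c_def d_def half powr_powr powr_add[symmetric] e ..
    show "c \<le> 2 powr (r * r) / 2"
      unfolding c_def half using r by (intro powr_mono) auto
  qed
  have "E \<le> ennreal (1 / 2) * E
      + (ennreal c * A + ennreal (2 powr (r * r) / 2) * enn_powr m r)"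
    using E_le unfolding cd(1)[symmetric] cd(2)[symmetric]
    by (simp add: c_def d_def ennreal_mult distrib_left add_ac mult_ac)
  also have "\<dots> \<le> ennreal (1 / 2) * E + ennreal (2 powr (r * r) / 2) * (A + enn_powr m r)"
    unfolding distrib_left[of _ A] using cd(3)
    by (intro add_left_mono add_right_mono mult_right_mono ennreal_leI) auto
  finally have "E \<le> 2 * (ennreal (2 powr (r * r) / 2) * (A + enn_powr m r))"
    using fin by (intro ennreal_le_half_add_imp) (simp_all add: E_def S_def)
  also have "\<dots> = ennreal (2 powr (r * r)) * (A + enn_powr m r)"
    by (simp flip: mult.assoc ennreal_mult ennreal_numeral)
  finally show ?thesis
    by (simp add: E_def A_def m_def S_def)
qed

lemma nn_integral_enn_powr_sum_finite:
  fixes X :: "nat \<Rightarrow> 'a \<Rightarrow> ennreal" and n :: nat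
  assumes "\<And>k. X k \<in> borel_measurable M" "0 \<le> r"
    and "\<And>k. (\<integral>\<^sup>+\<omega>. enn_powr (X k \<omega>) r \<partial>M) < \<top>"
  shows "(\<integral>\<^sup>+\<omega>. enn_powr (\<Sum>k<n. X k \<omega>) r \<partial>M) < \<top>"
proof (induction n)
  case (Suc n)
  note assms(1)[measurable]
  have "(\<integral>\<^sup>+\<omega>. enn_powr (\<Sum>k<Suc n. X k \<omega>) r \<partial>M)
      \<le> (\<integral>\<^sup>+\<omega>. ennreal (2 powr r) * (enn_powr (\<Sum>k<n. X k \<omega>) r + enn_powr (X n \<omega>) r) \<partial>M)"
    using assms(2) by (intro nn_integral_mono) (simp add: enn_powr_add_le)
  also have "\<dots> = ennreal (2 powr r) * ((\<integral>\<^sup>+\<omega>. enn_powr (\<Sum>k<n. X k \<omega>) r \<partial>M)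
      + (\<integral>\<^sup>+\<omega>. enn_powr (X n \<omega>) r \<partial>M))"
    by (subst nn_integral_cmult, measurable, subst nn_integral_add) auto
  also have "\<dots> < \<top>"
    using Suc assms(3) by (simp add: ennreal_mult_less_top)
  finally show ?case .
qed simp

text \<open>
  If the right-hand side is finite, all summands have a finite $r$-th moment, hence so have the finite
  partial sums, and absorption works for them. The constant does not depend on the number of
  summands, so monotone convergence gives the infinite sum.
\<close>

lemma Rosenthal_nonneg:
  fixes X :: "nat \<Rightarrow> 'a \<Rightarrow> ennreal"
  assumes X: "indep_vars (\<lambda>_. borel) X UNIV" and r: "1 \<le> r"
  shows "(\<integral>\<^sup>+\<omega>. enn_powr (\<Sum>k. X k \<omega>) r \<partial>M)
    \<le> ennreal (2 powr (r * r)) * ((\<Sum>k. \<integral>\<^sup>+\<omega>. enn_powr (X k \<omega>) r \<partial>M)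
        + enn_powr (\<Sum>k. \<integral>\<^sup>+\<omega>. X k \<omega> \<partial>M) r)"
    (is "_ \<le> ennreal ?C * (?A + enn_powr ?m r)")
proof (cases "?A = \<top>")
  case True
  then show ?thesis by (simp add: ennreal_mult_top)
next
  case False
  have [measurable]: "X k \<in> borel_measurable M" for k
    using X by (auto simp: indep_vars_def)
  have fin: "(\<integral>\<^sup>+\<omega>. enn_powr (X k \<omega>) r \<partial>M) < \<top>" for k
    using False ennreal_suminf_lessD[of "\<lambda>k. \<integral>\<^sup>+\<omega>. enn_powr (X k \<omega>) r \<partial>M" \<top> k]
    by (simp add: less_top)
  have partial: "(\<integral>\<^sup>+\<omega>. enn_powr (\<Sum>k<n. X k \<omega>) r \<partial>M) \<le> ennreal ?C * (?A + enn_powr ?m r)" for n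
  proof -
    define Y where "Y = (\<lambda>k \<omega>. if k < n then X k \<omega> else 0)"
    have "indep_vars (\<lambda>_. borel) (\<lambda>k \<omega>. (if k < n then (\<lambda>x. x) else (\<lambda>_. 0)) (X k \<omega>)) UNIV"
      by (rule indep_vars_compose2[OF X]) auto
    also have "(\<lambda>k \<omega>. (if k < n then (\<lambda>x. x) else (\<lambda>_. 0)) (X k \<omega>)) = Y"
      by (auto simp: Y_def fun_eq_iff)
    finally have indep: "indep_vars (\<lambda>_. borel) Y UNIV" .
    have sum_Y: "(\<Sum>k. Y k \<omega>) = (\<Sum>k<n. X k \<omega>)" for \<omega>
      by (subst suminf_finite[of "{..<n}"]) (auto simp: Y_def)
    have "(\<integral>\<^sup>+\<omega>. enn_powr (\<Sum>k<n. X k \<omega>) r \<partial>M)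
        \<le> ennreal ?C * ((\<Sum>k. \<integral>\<^sup>+\<omega>. enn_powr (Y k \<omega>) r \<partial>M)
          + enn_powr (\<Sum>k. \<integral>\<^sup>+\<omega>. Y k \<omega> \<partial>M) r)"
      using Rosenthal_of_finite_moment[OF indep r]
        nn_integral_enn_powr_sum_finite[of X r n] fin r by (simp add: sum_Y)
    also have "\<dots> \<le> ennreal ?C * (?A + enn_powr ?m r)"
      using r by (intro mult_left_mono add_mono enn_powr_mono suminf_le nn_integral_mono)
        (auto simp: Y_def)
    finally show ?thesis .
  qed
  have "(\<integral>\<^sup>+\<omega>. enn_powr (\<Sum>k. X k \<omega>) r \<partial>M)
      = (\<integral>\<^sup>+\<omega>. (SUP n. enn_powr (\<Sum>k<n. X k \<omega>) r) \<partial>M)"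
    using r by (simp add: suminf_eq_SUP enn_powr_SUP)
  also have "\<dots> = (SUP n. \<integral>\<^sup>+\<omega>. enn_powr (\<Sum>k<n. X k \<omega>) r \<partial>M)"
    using r by (intro nn_integral_monotone_convergence_SUP)
      (auto simp: incseq_def le_fun_def intro!: enn_powr_mono sum_mono2)
  also have "\<dots> \<le> ennreal ?C * (?A + enn_powr ?m r)"
    by (rule SUP_least) (rule partial)
  finally show ?thesis .
qed

section \<open>Truncation of independent nonnegative summands\<close>

text \<open>
  Markov's inequality for $S^r$ at the level $2 E S^r$. If the moment vanishes, the level is $0$, and
  the bound holds because $S = 0$ almost everywhere.
\<close>

lemma half_le_emeasure_le_moment:
  fixes S :: "'a \<Rightarrow> ennreal"
  assumes [measurable]: "S \<in> borel_measurable M" and r: "0 < r"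
    and N: "N = (\<integral>\<^sup>+\<omega>. enn_powr (S \<omega>) r \<partial>M)" "N < \<top>"
  shows "1 \<le> 2 * emeasure M {\<omega> \<in> space M. S \<omega> \<le> enn_powr (2 * N) (1 / r)}"
proof -
  let ?T = "enn_powr (2 * N) (1 / r)"
  let ?B = "{\<omega> \<in> space M. S \<omega> \<le> ?T}"
  have le_iff: "S \<omega> \<le> ?T \<longleftrightarrow> enn_powr (S \<omega>) r \<le> 2 * N" for \<omega>
    by (rule enn_powr_le_iff[OF r, symmetric])
  show ?thesis
  proof (cases "N = 0")
    case True
    then have "AE \<omega> in M. enn_powr (S \<omega>) r = 0"
      unfolding N by (subst (asm) nn_integral_0_iff_AE) auto
    then have "AE \<omega> in M. S \<omega> \<le> ?T"
      unfolding le_iff by eventually_elim simp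
    then have "emeasure M ?B = 1"
      by (intro emeasure_eq_1_AE) auto
    then show ?thesis by simp
  next
    case False
    have "2 * N = (\<integral>\<^sup>+\<omega>. 2 * N \<partial>M)"
      by (simp add: emeasure_space_1)
    also have "\<dots> \<le> (\<integral>\<^sup>+\<omega>. 2 * N * indicator ?B \<omega> + enn_powr (S \<omega>) r \<partial>M)"
    proof (rule nn_integral_mono)
      fix \<omega> assume \<omega>: "\<omega> \<in> space M"
      show "2 * N \<le> 2 * N * indicator ?B \<omega> + enn_powr (S \<omega>) r"
      proof (cases "S \<omega> \<le> ?T")
        case True
        with \<omega> show ?thesis by simp
      next
        case False
        then have "2 * N \<le> enn_powr (S \<omega>) r"
          unfolding le_iff by simp
        then show ?thesis by (rule add_increasing[OF zero_le])
      qed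
    qed
    also have "\<dots> = 2 * N * emeasure M ?B + N"
      by (subst nn_integral_add) (simp_all add: nn_integral_cmult flip: N(1))
    also have "2 * N * emeasure M ?B = N * (2 * emeasure M ?B)"
      by (simp only: mult_ac)
    finally have "N + N * 1 \<le> N + N * (2 * emeasure M ?B)"
      by (simp only: mult_2 mult_1_right add.commute)
    then have "N * 1 \<le> N * (2 * emeasure M ?B)"
      using N(2) by (subst (asm) ennreal_add_left_cancel_le) auto
    then show ?thesis
      using False N(2) by (subst (asm) ennreal_mult_le_mult_iff) auto
  qed
qed

text \<open>
  If $S$ is at most $T$ with probability at least $1/2$, then so is the sum $R_k \<le> S$ of all
  terms but the $k$-th. As $R_k$ is independent of $X_k$, restricting the expectation of $u(X_k)$ to
  the event $R_k \<le> T$ loses at most a factor $2$. On these events the sum over $k$ can be bounded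
  pointwise, which the next lemmas do for large and small values of $X_k$.
\<close>

lemma sum_nn_integral_le_decoupled:
  fixes X :: "nat \<Rightarrow> 'a \<Rightarrow> ennreal"
  assumes X: "indep_vars (\<lambda>_. borel) X UNIV"
    and T: "1 \<le> 2 * emeasure M {\<omega> \<in> space M. (\<Sum>k. X k \<omega>) \<le> T}"
    and [measurable]: "u \<in> borel_measurable borel"
  shows "(\<Sum>k. \<integral>\<^sup>+\<omega>. u (X k \<omega>) \<partial>M)
    \<le> 2 * (\<integral>\<^sup>+\<omega>. (\<Sum>k. u (X k \<omega>) * indicator {..T} (sum_without k (\<lambda>j. X j \<omega>))) \<partial>M)"
proof -
  have [measurable]: "X k \<in> borel_measurable M" for k
    using X by (auto simp: indep_vars_def)
  define P where "P = (\<lambda>k. \<integral>\<^sup>+\<omega>. indicator {..T} (sum_without k (\<lambda>j. X j \<omega>)) \<partial>M)"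
  have P: "1 \<le> 2 * P k" for k
  proof -
    have "emeasure M {\<omega> \<in> space M. (\<Sum>k. X k \<omega>) \<le> T}
        = (\<integral>\<^sup>+\<omega>. indicator {\<omega> \<in> space M. (\<Sum>k. X k \<omega>) \<le> T} \<omega> \<partial>M)"
      by simp
    also have "\<dots> \<le> P k"
      unfolding P_def
      by (intro nn_integral_mono)
        (auto simp: indicator_def intro: order_trans[OF sum_without_le])
    finally show ?thesis
      using T by (meson mult_left_mono order_trans zero_le)
  qed
  have "(\<Sum>k. \<integral>\<^sup>+\<omega>. u (X k \<omega>) \<partial>M) \<le> (\<Sum>k. 2 * ((\<integral>\<^sup>+\<omega>. u (X k \<omega>) \<partial>M) * P k))"
  proof (rule suminf_le)
    fix k
    show "(\<integral>\<^sup>+\<omega>. u (X k \<omega>) \<partial>M) \<le> 2 * ((\<integral>\<^sup>+\<omega>. u (X k \<omega>) \<partial>M) * P k)"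
      using mult_left_mono[OF P, of "\<integral>\<^sup>+\<omega>. u (X k \<omega>) \<partial>M" k] by (simp add: mult_ac)
  qed auto
  also have "\<dots> = 2 * (\<Sum>k. (\<integral>\<^sup>+\<omega>. u (X k \<omega>) * indicator {..T} (sum_without k (\<lambda>j. X j \<omega>)) \<partial>M))"
    unfolding P_def by (subst nn_integral_mult_sum_without[OF X]) auto
  also have "\<dots> = 2 * (\<integral>\<^sup>+\<omega>. (\<Sum>k. u (X k \<omega>) * indicator {..T} (sum_without k (\<lambda>j. X j \<omega>))) \<partial>M)"
    by (subst nn_integral_suminf) auto
  finally show ?thesis .
qed

lemma suminf_single:
  fixes b :: "nat \<Rightarrow> ennreal"
  assumes "\<And>j. j \<noteq> k \<Longrightarrow> b j = 0"
  shows "suminf b = b k"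
  by (subst suminf_finite[of "{k}"]) (use assms in auto)

text \<open>
  The events $X_k > T \<ge> R_k$ are pairwise disjoint, since $X_k > T$ forces $R_j > T$ for $j \<noteq> k$.
  So at most one term of the decoupled sum is nonzero, and it is at most $S^r$.
\<close>

lemma sum_moments_large_part_le:
  fixes X :: "nat \<Rightarrow> 'a \<Rightarrow> ennreal"
  assumes X: "indep_vars (\<lambda>_. borel) X UNIV"
    and T: "1 \<le> 2 * emeasure M {\<omega> \<in> space M. (\<Sum>k. X k \<omega>) \<le> T}"
    and r: "0 \<le> r"
  shows "(\<Sum>k. \<integral>\<^sup>+\<omega>. enn_powr (X k \<omega>) r * indicator {T<..} (X k \<omega>) \<partial>M)
    \<le> 2 * (\<integral>\<^sup>+\<omega>. enn_powr (\<Sum>k. X k \<omega>) r \<partial>M)"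
proof -
  have "(\<Sum>k. enn_powr (X k \<omega>) r * indicator {T<..} (X k \<omega>)
        * indicator {..T} (sum_without k (\<lambda>j. X j \<omega>)))
      \<le> enn_powr (\<Sum>k. X k \<omega>) r" (is "suminf ?a \<le> _") for \<omega>
  proof (cases "\<exists>k. T < X k \<omega> \<and> sum_without k (\<lambda>j. X j \<omega>) \<le> T")
    case True
    then obtain k where k: "T < X k \<omega>" "sum_without k (\<lambda>j. X j \<omega>) \<le> T" by blast
    then have "\<not> T < X j \<omega>" if "j \<noteq> k" for j
      using le_sum_without[OF that, of "\<lambda>j. X j \<omega>"] by (simp add: not_less)
    then have "?a j = 0" if "j \<noteq> k" for j
      using that by simp
    then have "suminf ?a = ?a k"
      by (rule suminf_single)
    also have "\<dots> \<le> enn_powr (X k \<omega>) r"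
      by (simp add: indicator_def)
    also have "\<dots> \<le> enn_powr (\<Sum>k. X k \<omega>) r"
      using r by (intro enn_powr_mono) (simp_all add: suminf_eq_sum_without[of _ k])
    finally show ?thesis .
  next
    case False
    then have "?a = (\<lambda>_. 0)"
      by (auto simp: indicator_def fun_eq_iff)
    then show ?thesis by simp
  qed
  then have "(\<integral>\<^sup>+\<omega>. (\<Sum>k. enn_powr (X k \<omega>) r * indicator {T<..} (X k \<omega>)
        * indicator {..T} (sum_without k (\<lambda>j. X j \<omega>))) \<partial>M)
      \<le> (\<integral>\<^sup>+\<omega>. enn_powr (\<Sum>k. X k \<omega>) r \<partial>M)"
    by (rule nn_integral_mono)
  then show ?thesis
    by (intro order_trans[OF sum_nn_integral_le_decoupled[OF X T]] mult_left_mono) auto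
qed

text \<open>
  If $X_k \<le> T$ and $R_k \<le> T$ for some $k$, then $S \<le> 2T$. So the decoupled sum vanishes unless
  $S \<le> 2T$, and it is always at most $S$.
\<close>

lemma sum_means_small_part_le:
  fixes X :: "nat \<Rightarrow> 'a \<Rightarrow> ennreal"
  assumes X: "indep_vars (\<lambda>_. borel) X UNIV"
    and T: "1 \<le> 2 * emeasure M {\<omega> \<in> space M. (\<Sum>k. X k \<omega>) \<le> T}"
  shows "(\<Sum>k. \<integral>\<^sup>+\<omega>. X k \<omega> * indicator {..T} (X k \<omega>) \<partial>M) \<le> 4 * T"
proof -
  have "(\<Sum>k. X k \<omega> * indicator {..T} (X k \<omega>)
        * indicator {..T} (sum_without k (\<lambda>j. X j \<omega>))) \<le> 2 * T" (is "suminf ?a \<le> _") for \<omega>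
  proof (cases "(\<Sum>k. X k \<omega>) \<le> 2 * T")
    case True
    have "suminf ?a \<le> (\<Sum>k. X k \<omega>)"
      by (intro suminf_le) (auto simp: indicator_def)
    then show ?thesis using True by simp
  next
    case False
    have "?a k = 0" for k
    proof (rule ccontr)
      assume "?a k \<noteq> 0"
      then have "X k \<omega> \<le> T" "sum_without k (\<lambda>j. X j \<omega>) \<le> T"
        by (auto simp: indicator_def split: if_splits)
      then have "(\<Sum>k. X k \<omega>) \<le> 2 * T"
        unfolding suminf_eq_sum_without[of _ k] mult_2 by (rule add_mono)
      then show False using False by simp
    qed
    then have "?a = (\<lambda>_. 0)" by (rule ext)
    then show ?thesis by (simp only: suminf_zero zero_le)
  qed
  then have "(\<integral>\<^sup>+\<omega>. (\<Sum>k. X k \<omega> * indicator {..T} (X k \<omega>)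
        * indicator {..T} (sum_without k (\<lambda>j. X j \<omega>))) \<partial>M) \<le> (\<integral>\<^sup>+\<omega>. 2 * T \<partial>M)"
    by (rule nn_integral_mono)
  also have "\<dots> = 2 * T"
    by (simp add: emeasure_space_1)
  finally have "(\<Sum>k. \<integral>\<^sup>+\<omega>. X k \<omega> * indicator {..T} (X k \<omega>) \<partial>M) \<le> 2 * (2 * T)"
    by (intro order_trans[OF sum_nn_integral_le_decoupled[OF X T]] mult_left_mono) auto
  then show ?thesis
    by (simp flip: mult.assoc)
qed

end

section \<open>Disjoint sums on the half-line\<close>

lemma borel_measurable_halfline_indicator:
  fixes G :: "real \<Rightarrow> ennreal"
  assumes "G \<in> borel_measurable halfline_leb"
  shows "(\<lambda>t. G t * indicator {0<..} t) \<in> borel_measurable lebesgue"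
  using assms by (subst (asm) borel_measurable_restrict_space_iff_ennreal) auto

lemma measurable_translation_lebesgue: "(\<lambda>t::real. t + a) \<in> lebesgue \<rightarrow>\<^sub>M lebesgue"
  using lebesgue_affine_measurable[of "\<lambda>_::real. 1" a] by (simp add: add.commute)

lemma measurable_shift_halfline [measurable]:
  "(\<lambda>t. t + real k) \<in> unit_leb \<rightarrow>\<^sub>M halfline_leb"
  by (intro measurable_restrict_space2 measurable_restrict_space1 measurable_translation_lebesgue)
    (auto simp: space_restrict_space)

text \<open>
  Up to the null set of integers, the half-line is the disjoint union of the translates
  $(k, k+1)$ of the unit interval.
\<close>

lemma nn_integral_halfline:
  assumes "G \<in> borel_measurable halfline_leb"
  shows "(\<integral>\<^sup>+t. G t \<partial>halfline_leb) = (\<Sum>k. \<integral>\<^sup>+t. G (t + real k) \<partial>unit_leb)"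
proof -
  define H where "H t = G t * indicator {0<..} t" for t
  have H [measurable]: "H \<in> borel_measurable lebesgue"
    unfolding H_def using assms by (rule borel_measurable_halfline_indicator)
  let ?I = "\<lambda>k::nat. {real k<..<real k + 1}"
  have disj: "disjoint_family ?I"
  proof -
    have "\<lfloor>t\<rfloor> = int k" if "t \<in> ?I k" for t k
      using that by (intro floor_unique) auto
    then show ?thesis
      by (force simp: disjoint_family_on_def)
  qed
  have piece: "(\<integral>\<^sup>+t\<in>?I k. H t \<partial>lebesgue) = (\<integral>\<^sup>+t. G (t + real k) \<partial>unit_leb)" for k
  proof -
    have meas: "(\<lambda>t. H t * indicator (?I k) t) \<in> borel_measurable lebesgue"
      using H by (rule borel_measurable_times_ennreal) (rule borel_measurable_indicator, simp)
    have "(\<integral>\<^sup>+t\<in>?I k. H t \<partial>lebesgue)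
        = (\<integral>\<^sup>+t. H (real k + 1 * t) * indicator (?I k) (real k + 1 * t) \<partial>lebesgue)"
      using meas by (subst nn_integral_real_affine_lebesgue[of _ 1 "real k"]) auto
    also have "\<dots> = (\<integral>\<^sup>+t. G (t + real k) * indicator {0<..<1} t \<partial>lebesgue)"
      by (intro nn_integral_cong) (auto simp: H_def indicator_def add.commute)
    also have "\<dots> = (\<integral>\<^sup>+t. G (t + real k) \<partial>unit_leb)"
      by (rule nn_integral_restrict_space[symmetric]) simp
    finally show ?thesis .
  qed
  have "range real \<in> null_sets lebesgue"
    by (intro null_sets_completionI countable_imp_null_set_lborel) auto
  then have "AE t in lebesgue. t \<notin> range real"
    by (rule AE_not_in)
  then have "AE t in lebesgue. H t = H t * indicator (\<Union>k. ?I k) t"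
  proof eventually_elim
    case (elim t)
    show ?case
    proof (cases "0 < t")
      case True
      have "t \<noteq> real (nat \<lfloor>t\<rfloor>)"
        using elim by blast
      then have "t \<in> ?I (nat \<lfloor>t\<rfloor>)"
        using True by (simp, linarith)
      then have "t \<in> (\<Union>k. ?I k)" by blast
      then show ?thesis by (simp only: indicator_simps mult_1_right)
    qed (simp add: H_def)
  qed
  then have "(\<integral>\<^sup>+t. H t \<partial>lebesgue) = (\<integral>\<^sup>+t\<in>(\<Union>k. ?I k). H t \<partial>lebesgue)"
    by (rule nn_integral_cong_AE)
  also have "\<dots> = (\<Sum>k. \<integral>\<^sup>+t\<in>?I k. H t \<partial>lebesgue)"
    by (rule nn_integral_disjoint_family) (use disj H in auto)
  also have "\<dots> = (\<Sum>k. \<integral>\<^sup>+t. G (t + real k) \<partial>unit_leb)"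
    by (simp only: piece)
  finally have "(\<integral>\<^sup>+t. H t \<partial>lebesgue) = (\<Sum>k. \<integral>\<^sup>+t. G (t + real k) \<partial>unit_leb)" .
  moreover have "(\<integral>\<^sup>+t. G t \<partial>halfline_leb) = (\<integral>\<^sup>+t. H t \<partial>lebesgue)"
    unfolding H_def by (rule nn_integral_restrict_space) simp
  ultimately show ?thesis by simp
qed

lemma disjoint_sum_shift:
  assumes "t \<in> {0<..<1}"
  shows "disjoint_sum f (t + real k) = f k t"
proof -
  have "indicator {real j<..<real j + 1} (t + real k) = (0::real)" if "j \<noteq> k" for j
    using that assms by (cases j k rule: linorder_cases) (auto simp: indicator_def)
  then show ?thesis
    unfolding disjoint_sum_def using assms by (subst suminf_finite[of "{k}"]) auto
qed

lemma measurable_disjoint_sum: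
  assumes "\<And>k. f k \<in> borel_measurable unit_leb"
  shows "disjoint_sum f \<in> borel_measurable halfline_leb"
proof -
  have "(\<lambda>t. f k (t - real k) * indicator {real k<..<real k + 1} t) \<in> borel_measurable lebesgue" for k
  proof -
    have "(\<lambda>t. indicator {0<..<1} t *\<^sub>R f k t) \<in> borel_measurable lebesgue"
      using assms[of k] by (subst (asm) borel_measurable_restrict_space_iff) auto
    from measurable_compose[OF measurable_translation_lebesgue[of "- real k"] this]
    have "(\<lambda>t. indicator {0<..<1} (t - real k) *\<^sub>R f k (t - real k)) \<in> borel_measurable lebesgue"
      by simp
    also have "(\<lambda>t. indicator {0<..<1} (t - real k) *\<^sub>R f k (t - real k))
        = (\<lambda>t. f k (t - real k) * indicator {real k<..<real k + 1} t)"
      by (auto simp: indicator_def fun_eq_iff)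
    finally show ?thesis .
  qed
  then have "disjoint_sum f \<in> borel_measurable lebesgue"
    unfolding disjoint_sum_def[abs_def] by (rule borel_measurable_suminf)
  then show ?thesis
    by (rule measurable_restrict_space1)
qed

section \<open>The mixed norm and the norms of the disjoint sum\<close>

lemma Lp_qnorm_real_eq:
  "Lp_qnorm_real M p g = enn_powr (\<integral>\<^sup>+t. ennreal (\<bar>g t\<bar> powr p) \<partial>M) (1 / p)"
  by (simp add: Lp_qnorm_def enn_powr_ennreal)

lemma Lp_qnorm_real_halfline:
  assumes [measurable]: "g \<in> borel_measurable halfline_leb"
  shows "Lp_qnorm_real halfline_leb p g
    = enn_powr (\<Sum>k. \<integral>\<^sup>+t. ennreal (\<bar>g (t + real k)\<bar> powr p) \<partial>unit_leb) (1 / p)"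
  unfolding Lp_qnorm_real_eq by (subst nn_integral_halfline) auto

lemma Lp_qnorm_lq_qnorm:
  "Lp_qnorm M p (\<lambda>t. lq_qnorm q (\<lambda>k. f k t))
    = enn_powr (\<integral>\<^sup>+t. enn_powr (\<Sum>k. ennreal (\<bar>f k t\<bar> powr q)) (p / q) \<partial>M) (1 / p)"
  by (simp add: Lp_qnorm_def lq_qnorm_def enn_powr_powr)

lemma le_cmult_Inf_ennreal:
  fixes y :: ennreal
  assumes "0 < C" "\<And>x. x \<in> A \<Longrightarrow> y \<le> ennreal C * x"
  shows "y \<le> ennreal C * Inf A"
proof -
  have inv: "ennreal C * (ennreal (1 / C) * z) = z" "ennreal (1 / C) * (ennreal C * z) = z" for z
    using assms(1) by (simp_all flip: mult.assoc ennreal_mult)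
  have "ennreal (1 / C) * y \<le> Inf A"
  proof (rule Inf_greatest)
    fix x assume "x \<in> A"
    from mult_left_mono[OF assms(2)[OF this], of "ennreal (1 / C)"]
    show "ennreal (1 / C) * y \<le> x" by (simp add: inv)
  qed
  from mult_left_mono[OF this, of "ennreal C"] show ?thesis
    by (simp add: inv)
qed

interpretation unit: prob_space unit_leb
  by (rule prob_space_unit_leb)

text \<open>
  Let $r = p/q \<le> 1$. Cut $g$ and $h$ into pieces $g_k$ and $h_k$ on the unit interval. Pointwise
  $\<Sum>_k |f_k|^q \<le> 2^q (\<Sum>_k |g_k|^q + \<Sum>_k |h_k|^q)$. Raise this to the power $r$: the first sum
  is handled by subadditivity, $(\<Sum>_k |g_k|^q)^r \<le> \<Sum>_k |g_k|^p$, which integrates to $\<parallel>g\<parallel>_p^p$, and the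
  second by Jensen's inequality, which leads to $\<parallel>h\<parallel>_q^p$.
\<close>

lemma square_function_le_sum_norm:
  fixes f :: "nat \<Rightarrow> real \<Rightarrow> real"
  assumes pq: "0 < p" "p \<le> q"
    and f [measurable]: "\<And>k. f k \<in> borel_measurable unit_leb"
    and g: "g \<in> borel_measurable halfline_leb" and h: "h \<in> borel_measurable halfline_leb"
    and decomp: "AE t in halfline_leb. disjoint_sum f t = g t + h t"
  shows "Lp_qnorm unit_leb p (\<lambda>t. lq_qnorm q (\<lambda>k. f k t))
    \<le> ennreal ((2 powr (p + p / q + 2)) powr (1 / p))
      * (Lp_qnorm_real halfline_leb p g + Lp_qnorm_real halfline_leb q h)"
proof -
  define r where "r = p / q"
  have r: "0 < r" "r \<le> 1" "q * r = p" "1 \<le> 1 / r"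
    using pq by (auto simp: r_def)
  define a where "a = Lp_qnorm_real halfline_leb p g"
  define b where "b = Lp_qnorm_real halfline_leb q h"
  define D where "D = (\<lambda>t. disjoint_sum f t - h t)"
  define U where "U = (\<lambda>k t. ennreal (\<bar>f k t - h (t + real k)\<bar> powr q))"
  define V where "V = (\<lambda>k t. ennreal (\<bar>h (t + real k)\<bar> powr q))"
  note [measurable] = g h measurable_disjoint_sum[OF f]
  have [measurable]: "D \<in> borel_measurable halfline_leb"
    unfolding D_def by measurable
  have [measurable]: "U k \<in> borel_measurable unit_leb" "V k \<in> borel_measurable unit_leb" for k
    unfolding U_def V_def by measurable
  \<comment> \<open>Replacing $g$ by $f - h$ turns the almost everywhere decomposition into a pointwise one.\<close>
  have "a = Lp_qnorm_real halfline_leb p D"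
    unfolding a_def Lp_qnorm_real_eq
    by (intro arg_cong2[where f=enn_powr] nn_integral_cong_AE refl)
      (use decomp in eventually_elim, simp add: D_def)
  also have "\<dots> = enn_powr (\<Sum>k. \<integral>\<^sup>+t. enn_powr (U k t) r \<partial>unit_leb) (1 / p)"
    by (subst Lp_qnorm_real_halfline, simp,
        intro arg_cong2[where f=enn_powr] suminf_cong nn_integral_cong refl)
      (simp add: U_def D_def disjoint_sum_shift space_restrict_space enn_powr_ennreal powr_powr r)
  finally have U: "(\<Sum>k. \<integral>\<^sup>+t. enn_powr (U k t) r \<partial>unit_leb) = enn_powr a p"
    using pq by (simp add: enn_powr_powr)
  have "b = enn_powr (\<Sum>k. \<integral>\<^sup>+t. V k t \<partial>unit_leb) (1 / q)"
    unfolding b_def V_def by (rule Lp_qnorm_real_halfline) simp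
  then have V: "enn_powr (\<Sum>k. \<integral>\<^sup>+t. V k t \<partial>unit_leb) r = enn_powr b p"
    using pq by (simp add: enn_powr_powr r_def)
  let ?c = "2 powr (p + r) :: real"
  have pointwise: "enn_powr (\<Sum>k. ennreal (\<bar>f k t\<bar> powr q)) r
      \<le> ennreal ?c * (enn_powr (\<Sum>k. U k t) r + enn_powr (\<Sum>k. V k t) r)" for t
  proof -
    have "(\<Sum>k. ennreal (\<bar>f k t\<bar> powr q)) \<le> (\<Sum>k. ennreal (2 powr q) * (U k t + V k t))"
    proof (rule suminf_le)
      fix k
      have "ennreal \<bar>f k t\<bar> \<le> ennreal (\<bar>f k t - h (t + real k)\<bar> + \<bar>h (t + real k)\<bar>)"
        by (intro ennreal_leI) linarith
      also have "\<dots> = ennreal \<bar>f k t - h (t + real k)\<bar> + ennreal \<bar>h (t + real k)\<bar>"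
        by (intro ennreal_plus abs_ge_zero)
      finally have "ennreal \<bar>f k t\<bar> \<le> ennreal \<bar>f k t - h (t + real k)\<bar> + ennreal \<bar>h (t + real k)\<bar>" .
      then have "enn_powr (ennreal \<bar>f k t\<bar>) q
          \<le> enn_powr (ennreal \<bar>f k t - h (t + real k)\<bar> + ennreal \<bar>h (t + real k)\<bar>) q"
        using pq by (intro enn_powr_mono) auto
      also have "\<dots> \<le> ennreal (2 powr q) * (U k t + V k t)"
        using pq enn_powr_add_le[of q "ennreal \<bar>f k t - h (t + real k)\<bar>" "ennreal \<bar>h (t + real k)\<bar>"]
        by (simp add: U_def V_def enn_powr_ennreal)
      finally show "ennreal (\<bar>f k t\<bar> powr q) \<le> ennreal (2 powr q) * (U k t + V k t)"
        by (simp add: enn_powr_ennreal)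
    qed auto
    also have "\<dots> = ennreal (2 powr q) * ((\<Sum>k. U k t) + (\<Sum>k. V k t))"
      by (simp add: suminf_add)
    finally have "enn_powr (\<Sum>k. ennreal (\<bar>f k t\<bar> powr q)) r
        \<le> enn_powr (ennreal (2 powr q) * ((\<Sum>k. U k t) + (\<Sum>k. V k t))) r"
      using r(1) by (intro enn_powr_mono) auto
    also have "\<dots> = ennreal (2 powr p) * enn_powr ((\<Sum>k. U k t) + (\<Sum>k. V k t)) r"
      using r(3) by (simp add: enn_powr_cmult powr_powr)
    also have "\<dots> \<le> ennreal (2 powr p) * (ennreal (2 powr r)
        * (enn_powr (\<Sum>k. U k t) r + enn_powr (\<Sum>k. V k t) r))"
      using r(1) by (intro mult_left_mono enn_powr_add_le) auto
    also have "\<dots> = ennreal ?c * (enn_powr (\<Sum>k. U k t) r + enn_powr (\<Sum>k. V k t) r)"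
      by (simp add: powr_add ennreal_mult mult.assoc)
    finally show ?thesis .
  qed
  have "(\<integral>\<^sup>+t. enn_powr (\<Sum>k. U k t) r \<partial>unit_leb) \<le> (\<integral>\<^sup>+t. (\<Sum>k. enn_powr (U k t) r) \<partial>unit_leb)"
    using r(1,2) by (intro nn_integral_mono enn_powr_suminf_le)
  also have "\<dots> = enn_powr a p"
    unfolding U[symmetric] by (rule nn_integral_suminf) measurable
  finally have U_le: "(\<integral>\<^sup>+t. enn_powr (\<Sum>k. U k t) r \<partial>unit_leb) \<le> enn_powr a p" .
  have "(\<integral>\<^sup>+t. enn_powr (\<Sum>k. V k t) r \<partial>unit_leb)
      \<le> 2 * enn_powr (\<integral>\<^sup>+t. (\<Sum>k. V k t) \<partial>unit_leb) r"
    \<comment> \<open>The exponent $1/r \<ge> 1$ is applied to the $r$-th power of the sum.\<close>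
    using unit.nn_integral_le_moment[of "\<lambda>t. enn_powr (\<Sum>k. V k t) r" "1 / r"] r(1,4)
    by (simp add: enn_powr_powr)
  also have "(\<integral>\<^sup>+t. (\<Sum>k. V k t) \<partial>unit_leb) = (\<Sum>k. \<integral>\<^sup>+t. V k t \<partial>unit_leb)"
    by (rule nn_integral_suminf) measurable
  finally have V_le: "(\<integral>\<^sup>+t. enn_powr (\<Sum>k. V k t) r \<partial>unit_leb) \<le> 2 * enn_powr b p"
    unfolding V .
  have "(\<integral>\<^sup>+t. enn_powr (\<Sum>k. ennreal (\<bar>f k t\<bar> powr q)) r \<partial>unit_leb)
      \<le> (\<integral>\<^sup>+t. ennreal ?c * (enn_powr (\<Sum>k. U k t) r + enn_powr (\<Sum>k. V k t) r) \<partial>unit_leb)"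
    by (intro nn_integral_mono pointwise)
  also have "\<dots> = ennreal ?c * ((\<integral>\<^sup>+t. enn_powr (\<Sum>k. U k t) r \<partial>unit_leb)
      + (\<integral>\<^sup>+t. enn_powr (\<Sum>k. V k t) r \<partial>unit_leb))"
    by (subst nn_integral_cmult, measurable, subst nn_integral_add) auto
  also have "\<dots> \<le> ennreal ?c * (enn_powr (a + b) p + (enn_powr (a + b) p + 2 * enn_powr (a + b) p))"
  proof (intro mult_left_mono add_mono order_trans[OF U_le] order_trans[OF V_le])
    show "enn_powr a p \<le> enn_powr (a + b) p"
      using pq by (intro enn_powr_mono) auto
    have "enn_powr b p \<le> enn_powr (a + b) p"
      using pq by (intro enn_powr_mono) auto
    then show "2 * enn_powr b p \<le> enn_powr (a + b) p + 2 * enn_powr (a + b) p"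
      by (intro add_increasing mult_left_mono) auto
  qed auto
  also have "\<dots> = ennreal ?c * (4 * enn_powr (a + b) p)"
  proof -
    have "4 * z = (1 + (1 + 2)) * z" for z :: ennreal by simp
    then show ?thesis by (simp only: distrib_right mult_1)
  qed
  also have "\<dots> = ennreal (2 powr (p + r + 2)) * enn_powr (a + b) p"
    by (simp add: powr_add[of _ _ 2] ennreal_mult mult.assoc)
  finally show ?thesis
    unfolding Lp_qnorm_lq_qnorm r_def[symmetric] a_def[symmetric] b_def[symmetric]
    using pq enn_powr_mono[of "1 / p" _ "ennreal (2 powr (p + r + 2)) * enn_powr (a + b) p"]
    by (simp add: enn_powr_cmult enn_powr_powr)
qed

text \<open>
  With $N = E (\<Sum>_k |f_k|^q)^r$ and $T = (2N)^{1/r}$, split the disjoint sum into the part $g$ where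
  $|f|^q > T$ and the part $h$ where $|f|^q \<le> T$. The two truncation lemmas give
  $\<parallel>g\<parallel>_p^p \<le> 2N$ and $\<parallel>h\<parallel>_q^q \<le> 4T$, and $T^{1/q} = (2N)^{1/p}$.
\<close>

lemma sum_norm_le_square_function:
  fixes f :: "nat \<Rightarrow> real \<Rightarrow> real"
  assumes pq: "0 < p" "p \<le> q"
    and indep: "prob_space.indep_vars unit_leb (\<lambda>_. borel) f UNIV"
    and fin: "Lp_qnorm unit_leb p (\<lambda>t. lq_qnorm q (\<lambda>k. f k t)) < \<top>"
  shows "Lp_plus_Lq_qnorm halfline_leb p q (disjoint_sum f)
    \<le> ennreal (2 powr (1 / p) * (1 + 4 powr (1 / q)))
      * Lp_qnorm unit_leb p (\<lambda>t. lq_qnorm q (\<lambda>k. f k t))"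
proof -
  define r where "r = p / q"
  have r: "0 < r" "q * r = p" "1 / r * (1 / q) = 1 / p"
    using pq by (auto simp: r_def)
  define D where "D = disjoint_sum f"
  define X where "X = (\<lambda>k t. ennreal (\<bar>f k t\<bar> powr q))"
  define N where "N = (\<integral>\<^sup>+t. enn_powr (\<Sum>k. X k t) r \<partial>unit_leb)"
  define T where "T = enn_powr (2 * N) (1 / r)"
  have f: "f k \<in> borel_measurable unit_leb" for k
    using indep by (auto simp: unit.indep_vars_def)
  note [measurable] = f
  have [measurable]: "D \<in> borel_measurable halfline_leb"
    unfolding D_def by (rule measurable_disjoint_sum[OF f])
  have [measurable]: "X k \<in> borel_measurable unit_leb" for k
    unfolding X_def by measurable
  have indep_X: "unit.indep_vars (\<lambda>_. borel) X UNIV"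
    unfolding X_def by (rule unit.indep_vars_compose2[OF indep]) measurable
  have norm_eq: "Lp_qnorm unit_leb p (\<lambda>t. lq_qnorm q (\<lambda>k. f k t)) = enn_powr N (1 / p)"
    unfolding Lp_qnorm_lq_qnorm N_def X_def r_def ..
  have N_fin: "N < \<top>"
    using fin unfolding norm_eq by (cases "N = \<top>") (auto simp: top.not_eq_extremum)
  have T: "1 \<le> 2 * emeasure unit_leb {t \<in> space unit_leb. (\<Sum>k. X k t) \<le> T}"
    unfolding T_def using r(1) by (intro unit.half_le_emeasure_le_moment N_def N_fin) auto
  define g where "g = (\<lambda>t. if T < ennreal (\<bar>D t\<bar> powr q) then D t else 0)"
  define h where "h = (\<lambda>t. if T < ennreal (\<bar>D t\<bar> powr q) then 0 else D t)"
  have [measurable]: "g \<in> borel_measurable halfline_leb" "h \<in> borel_measurable halfline_leb"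
    unfolding g_def h_def by measurable
  have "Lp_qnorm_real halfline_leb p g
      = enn_powr (\<Sum>k. \<integral>\<^sup>+t. enn_powr (X k t) r * indicator {T<..} (X k t) \<partial>unit_leb) (1 / p)"
    by (subst Lp_qnorm_real_halfline, simp,
        intro arg_cong2[where f=enn_powr] suminf_cong nn_integral_cong refl)
      (auto simp: g_def D_def X_def disjoint_sum_shift space_restrict_space enn_powr_ennreal powr_powr r)
  also have "\<dots> \<le> enn_powr (2 * N) (1 / p)"
    unfolding N_def using pq r(1)
    by (intro enn_powr_mono unit.sum_moments_large_part_le[OF indep_X T]) auto
  also have "\<dots> = ennreal (2 powr (1 / p)) * enn_powr N (1 / p)"
    using enn_powr_cmult[of 2 N "1 / p"] by simp
  finally have g_le: "Lp_qnorm_real halfline_leb p g \<le> ennreal (2 powr (1 / p)) * enn_powr N (1 / p)" .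
  have "Lp_qnorm_real halfline_leb q h
      = enn_powr (\<Sum>k. \<integral>\<^sup>+t. X k t * indicator {..T} (X k t) \<partial>unit_leb) (1 / q)"
    by (subst Lp_qnorm_real_halfline, simp,
        intro arg_cong2[where f=enn_powr] suminf_cong nn_integral_cong refl)
      (auto simp: h_def D_def X_def disjoint_sum_shift space_restrict_space)
  also have "\<dots> \<le> enn_powr (4 * T) (1 / q)"
    using pq by (intro enn_powr_mono unit.sum_means_small_part_le[OF indep_X T]) auto
  also have "\<dots> = ennreal (4 powr (1 / q)) * enn_powr (2 * N) (1 / p)"
    using enn_powr_cmult[of 4 T "1 / q"] r(3) by (simp add: T_def enn_powr_powr)
  also have "\<dots> = ennreal (4 powr (1 / q)) * (ennreal (2 powr (1 / p)) * enn_powr N (1 / p))"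
    using enn_powr_cmult[of 2 N "1 / p"] by simp
  finally have h_le: "Lp_qnorm_real halfline_leb q h
      \<le> ennreal (4 powr (1 / q)) * (ennreal (2 powr (1 / p)) * enn_powr N (1 / p))" .
  have N_fin': "enn_powr N (1 / p) < \<top>"
    using N_fin by (simp add: enn_powr_def less_top)
  have "Lp_plus_Lq_qnorm halfline_leb p q D
      \<le> Lp_qnorm_real halfline_leb p g + Lp_qnorm_real halfline_leb q h"
    unfolding Lp_plus_Lq_qnorm_def
  proof (rule Inf_lower, intro CollectI exI conjI)
    show "g \<in> Lp_space halfline_leb p" "h \<in> Lp_space halfline_leb q"
      unfolding Lp_space_def
      by (auto intro!: le_less_trans[OF g_le] le_less_trans[OF h_le]
          simp: ennreal_mult_less_top N_fin')
  qed (auto simp: g_def h_def)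
  also have "\<dots> \<le> ennreal (2 powr (1 / p)) * enn_powr N (1 / p)
      + ennreal (4 powr (1 / q)) * (ennreal (2 powr (1 / p)) * enn_powr N (1 / p))"
    by (rule add_mono[OF g_le h_le])
  also have "\<dots> = ennreal (2 powr (1 / p) * (1 + 4 powr (1 / q))) * enn_powr N (1 / p)"
    by (simp add: ennreal_mult distrib_left distrib_right mult_ac)
  finally show ?thesis
    unfolding norm_eq D_def .
qed

text \<open>
  Put $X_k = |f_k|^q$ and $r = p/q \<ge> 1$. The intersection norm is the maximum of
  $(\<Sum>_k E X_k^r)^{1/p}$ and $(\<Sum>_k E X_k)^{1/q}$. Superadditivity of the $r$-th power bounds the
  first by the mixed norm, Jensen's inequality bounds the second, and the converse
  estimate is Rosenthal's inequality.
\<close>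

lemma square_function_equiv_inter_norm:
  fixes f :: "nat \<Rightarrow> real \<Rightarrow> real"
  assumes pq: "0 < q" "q \<le> p"
    and indep: "prob_space.indep_vars unit_leb (\<lambda>_. borel) f UNIV"
  defines "r \<equiv> p / q"
  shows "Lp_inter_Lq_qnorm halfline_leb p q (disjoint_sum f)
      \<le> ennreal (2 powr (1 / q)) * Lp_qnorm unit_leb p (\<lambda>t. lq_qnorm q (\<lambda>k. f k t))" (is ?lower)
    and "Lp_qnorm unit_leb p (\<lambda>t. lq_qnorm q (\<lambda>k. f k t))
      \<le> ennreal ((2 powr (r * r + 1)) powr (1 / p))
        * Lp_inter_Lq_qnorm halfline_leb p q (disjoint_sum f)" (is ?upper)
proof -
  have r: "1 \<le> r" "q * r = p" "1 / r * (1 / q) = 1 / p"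
    using pq by (auto simp: r_def)
  define X where "X = (\<lambda>k t. ennreal (\<bar>f k t\<bar> powr q))"
  define N where "N = (\<integral>\<^sup>+t. enn_powr (\<Sum>k. X k t) r \<partial>unit_leb)"
  define A where "A = (\<Sum>k. \<integral>\<^sup>+t. enn_powr (X k t) r \<partial>unit_leb)"
  define m where "m = (\<Sum>k. \<integral>\<^sup>+t. X k t \<partial>unit_leb)"
  define I where "I = Lp_inter_Lq_qnorm halfline_leb p q (disjoint_sum f)"
  have f: "f k \<in> borel_measurable unit_leb" for k
    using indep by (auto simp: unit.indep_vars_def)
  note [measurable] = f measurable_disjoint_sum[OF f]
  have [measurable]: "X k \<in> borel_measurable unit_leb" for k
    unfolding X_def by measurable
  have indep_X: "unit.indep_vars (\<lambda>_. borel) X UNIV"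
    unfolding X_def by (rule unit.indep_vars_compose2[OF indep]) measurable
  have norm_eq: "Lp_qnorm unit_leb p (\<lambda>t. lq_qnorm q (\<lambda>k. f k t)) = enn_powr N (1 / p)"
    unfolding Lp_qnorm_lq_qnorm N_def X_def r_def ..
  have normp: "Lp_qnorm_real halfline_leb p (disjoint_sum f) = enn_powr A (1 / p)"
    unfolding A_def
    by (subst Lp_qnorm_real_halfline, simp,
        intro arg_cong2[where f=enn_powr] suminf_cong nn_integral_cong refl)
      (simp add: X_def disjoint_sum_shift space_restrict_space enn_powr_ennreal powr_powr r)
  have normq: "Lp_qnorm_real halfline_leb q (disjoint_sum f) = enn_powr m (1 / q)"
    unfolding m_def
    by (subst Lp_qnorm_real_halfline, simp,
        intro arg_cong2[where f=enn_powr] suminf_cong nn_integral_cong refl)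
      (simp add: X_def disjoint_sum_shift space_restrict_space)
  have I_eq: "I = max (enn_powr A (1 / p)) (enn_powr m (1 / q))"
    unfolding I_def Lp_inter_Lq_qnorm_def normp normq ..
  have "A = (\<integral>\<^sup>+t. (\<Sum>k. enn_powr (X k t) r) \<partial>unit_leb)"
    unfolding A_def by (rule nn_integral_suminf[symmetric]) measurable
  also have "\<dots> \<le> N"
    unfolding N_def using r(1) by (intro nn_integral_mono suminf_enn_powr_le)
  finally have "enn_powr A (1 / p) \<le> enn_powr N (1 / p)"
    using pq by (intro enn_powr_mono) auto
  also have "\<dots> \<le> ennreal (2 powr (1 / q)) * enn_powr N (1 / p)"
    using pq mult_right_mono[of 1 "ennreal (2 powr (1 / q))" "enn_powr N (1 / p)"]
    by (simp add: ge_one_powr_ge_zero)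
  finally have A_le: "enn_powr A (1 / p) \<le> ennreal (2 powr (1 / q)) * enn_powr N (1 / p)" .
  have "m = (\<integral>\<^sup>+t. (\<Sum>k. X k t) \<partial>unit_leb)"
    unfolding m_def by (rule nn_integral_suminf[symmetric]) measurable
  also have "\<dots> \<le> 2 * enn_powr N (1 / r)"
    unfolding N_def using r(1) by (intro unit.nn_integral_le_moment) auto
  finally have "enn_powr m (1 / q) \<le> enn_powr (2 * enn_powr N (1 / r)) (1 / q)"
    using pq by (intro enn_powr_mono) auto
  also have "\<dots> = ennreal (2 powr (1 / q)) * enn_powr N (1 / p)"
    using enn_powr_cmult[of 2 "enn_powr N (1 / r)" "1 / q"] r(3) by (simp add: enn_powr_powr)
  finally show ?lower
    unfolding norm_eq I_def[symmetric] I_eq using A_le by simp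
  have "A \<le> enn_powr I p"
    using pq enn_powr_le_iff[of "1 / p" A I] by (simp add: I_eq)
  moreover have "enn_powr (enn_powr m (1 / q)) p \<le> enn_powr I p"
    using pq by (intro enn_powr_mono) (auto simp: I_eq)
  then have "enn_powr m r \<le> enn_powr I p"
    using pq by (simp add: enn_powr_powr r_def)
  ultimately have "ennreal (2 powr (r * r)) * (A + enn_powr m r)
      \<le> ennreal (2 powr (r * r)) * (2 * enn_powr I p)"
    unfolding mult_2 by (intro mult_left_mono add_mono) auto
  also have "\<dots> = ennreal (2 powr (r * r + 1)) * enn_powr I p"
    by (simp add: powr_add ennreal_mult mult.assoc)
  finally have "N \<le> ennreal (2 powr (r * r + 1)) * enn_powr I p"
    unfolding N_def
    by (rule order_trans[OF unit.Rosenthal_nonneg[OF indep_X r(1)], folded A_def m_def])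
  then have "enn_powr N (1 / p) \<le> enn_powr (ennreal (2 powr (r * r + 1)) * enn_powr I p) (1 / p)"
    using pq by (intro enn_powr_mono) auto
  also have "\<dots> = ennreal ((2 powr (r * r + 1)) powr (1 / p)) * I"
    using pq by (simp add: enn_powr_cmult enn_powr_powr)
  finally show ?upper
    unfolding norm_eq I_def .
qed

lemma ennreal_inverse_cmult_le:
  fixes x y :: ennreal
  assumes "0 < C" "x \<le> ennreal C * y"
  shows "ennreal (1 / C) * x \<le> y"
  using mult_left_mono[OF assms(2), of "ennreal (1 / C)"] assms(1)
  by (simp flip: mult.assoc ennreal_mult)

theorem corollary1p2:
  shows
    "(\<forall>p q :: real. 0 < p \<and> p \<le> q \<longrightarrow>
       (\<exists>c C :: real. 0 < c \<and> 0 < C \<and>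
         (\<forall>f :: nat \<Rightarrow> real \<Rightarrow> real.
            (\<forall>k. f k \<in> Lp_space unit_leb p) \<and>
            prob_space.indep_vars unit_leb (\<lambda>_. borel) f UNIV \<longrightarrow>
              ennreal c * Lp_plus_Lq_qnorm halfline_leb p q (disjoint_sum f)
                \<le> Lp_qnorm unit_leb p (\<lambda>t. lq_qnorm q (\<lambda>k. f k t)) \<and>
              Lp_qnorm unit_leb p (\<lambda>t. lq_qnorm q (\<lambda>k. f k t))
                \<le> ennreal C * Lp_plus_Lq_qnorm halfline_leb p q (disjoint_sum f))))
     \<and>
     (\<forall>p q :: real. 0 < q \<and> q \<le> p \<longrightarrow>
       (\<exists>c C :: real. 0 < c \<and> 0 < C \<and>
         (\<forall>f :: nat \<Rightarrow> real \<Rightarrow> real.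
            (\<forall>k. f k \<in> Lp_space unit_leb p) \<and>
            prob_space.indep_vars unit_leb (\<lambda>_. borel) f UNIV \<longrightarrow>
              ennreal c * Lp_inter_Lq_qnorm halfline_leb p q (disjoint_sum f)
                \<le> Lp_qnorm unit_leb p (\<lambda>t. lq_qnorm q (\<lambda>k. f k t)) \<and>
              Lp_qnorm unit_leb p (\<lambda>t. lq_qnorm q (\<lambda>k. f k t))
                \<le> ennreal C * Lp_inter_Lq_qnorm halfline_leb p q (disjoint_sum f))))"
proof (intro conjI allI impI)
  fix p q :: real
  assume pq: "0 < p \<and> p \<le> q"
  let ?K = "2 powr (1 / p) * (1 + 4 powr (1 / q)) :: real"
  let ?C = "(2 powr (p + p / q + 2)) powr (1 / p) :: real"
  have K: "0 < ?K"
    by (simp add: add_pos_nonneg)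
  have C: "0 < ?C" by simp
  show "\<exists>c C :: real. 0 < c \<and> 0 < C \<and>
         (\<forall>f :: nat \<Rightarrow> real \<Rightarrow> real.
            (\<forall>k. f k \<in> Lp_space unit_leb p) \<and>
            prob_space.indep_vars unit_leb (\<lambda>_. borel) f UNIV \<longrightarrow>
              ennreal c * Lp_plus_Lq_qnorm halfline_leb p q (disjoint_sum f)
                \<le> Lp_qnorm unit_leb p (\<lambda>t. lq_qnorm q (\<lambda>k. f k t)) \<and>
              Lp_qnorm unit_leb p (\<lambda>t. lq_qnorm q (\<lambda>k. f k t))
                \<le> ennreal C * Lp_plus_Lq_qnorm halfline_leb p q (disjoint_sum f))"
  proof (rule exI[of _ "1 / ?K"], rule exI[of _ ?C], intro conjI allI impI; (elim conjE)?)
    fix f :: "nat \<Rightarrow> real \<Rightarrow> real"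
    let ?L = "Lp_qnorm unit_leb p (\<lambda>t. lq_qnorm q (\<lambda>k. f k t))"
    assume mem: "\<forall>k. f k \<in> Lp_space unit_leb p"
      and indep: "prob_space.indep_vars unit_leb (\<lambda>_. borel) f UNIV"
    show "ennreal (1 / ?K) * Lp_plus_Lq_qnorm halfline_leb p q (disjoint_sum f) \<le> ?L"
    proof (cases "?L < \<top>")
      case True
      then show ?thesis
        using pq indep by (intro ennreal_inverse_cmult_le[OF K] sum_norm_le_square_function) auto
    next
      case False
      then have "?L = \<top>" using top.not_eq_extremum by blast
      then show ?thesis by simp
    qed
    show "?L \<le> ennreal ?C * Lp_plus_Lq_qnorm halfline_leb p q (disjoint_sum f)"
      unfolding Lp_plus_Lq_qnorm_def
    proof (rule le_cmult_Inf_ennreal[OF C], elim CollectE exE conjE)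
      fix x g h
      assume x: "x = Lp_qnorm_real halfline_leb p g + Lp_qnorm_real halfline_leb q h"
        and gh: "g \<in> Lp_space halfline_leb p" "h \<in> Lp_space halfline_leb q"
          "AE t in halfline_leb. disjoint_sum f t = g t + h t"
      show "?L \<le> ennreal ?C * x"
        unfolding x using pq mem gh
        by (intro square_function_le_sum_norm) (auto simp: Lp_space_def)
    qed
  qed (use K in auto)
next
  fix p q :: real
  assume pq: "0 < q \<and> q \<le> p"
  let ?K = "2 powr (1 / q) :: real"
  let ?C = "(2 powr (p / q * (p / q) + 1)) powr (1 / p) :: real"
  show "\<exists>c C :: real. 0 < c \<and> 0 < C \<and>
         (\<forall>f :: nat \<Rightarrow> real \<Rightarrow> real.
            (\<forall>k. f k \<in> Lp_space unit_leb p) \<and>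
            prob_space.indep_vars unit_leb (\<lambda>_. borel) f UNIV \<longrightarrow>
              ennreal c * Lp_inter_Lq_qnorm halfline_leb p q (disjoint_sum f)
                \<le> Lp_qnorm unit_leb p (\<lambda>t. lq_qnorm q (\<lambda>k. f k t)) \<and>
              Lp_qnorm unit_leb p (\<lambda>t. lq_qnorm q (\<lambda>k. f k t))
                \<le> ennreal C * Lp_inter_Lq_qnorm halfline_leb p q (disjoint_sum f))"
    using pq by (intro exI[of _ "1 / ?K"] exI[of _ ?C] conjI allI impI ennreal_inverse_cmult_le
        square_function_equiv_inter_norm) auto
qed

end
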